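(* Every finite simple graph $G$ with exactly $5$ vertices satisfies $\mathrm{tww}(G)\le 2$.
   Context: A trigraph is a vertex set $V$ together with two disjoint sets of edges (unordered pairs of distinct vertices): black edges and red edges. A contraction of two distinct (not necessarily adjacent) vertices $u,v$ of a trigraph replaces them by a single new vertex $w$; every vertex $x\neq u,v$ that is adjacent (by an edge of either colour) to exactly one of $u,v$ becomes joined to $w$ by a red edge; every $x$ adjacent to both becomes joined to $w$ by a black edge if $ux$ and $vx$ are both black and by a red edge otherwise; all edges not incident to $u$ or $v$ are unchanged. A simple graph is viewed as a trigraph with no red edges. A $d$-sequence for an $n$-vertex graph $G$ is a sequence of trigraphs $G=G_n,G_{n-1},\dots,G_1$ in which each $G_{i-1}$ is obtained from $G_i$ by one contraction and every vertex of every $G_i$ is incident to at most $d$ red edges. The twin-width $\mathrm{tww}(G)$ is the least $d$ for which $G$ admits a $d$-sequence. *)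

theory Defs
  imports Main
begin

record 'a trigraph =
  verts :: "'a set"
  black :: "'a set set"
  red :: "'a set set"

definition vertex_pairs :: "'a set \<Rightarrow> 'a set set" where
  "vertex_pairs V = {{x, y} | x y. x \<in> V \<and> y \<in> V \<and> x \<noteq> y}"

definition is_trigraph :: "'a trigraph \<Rightarrow> bool" where
  "is_trigraph T \<longleftrightarrow>
     finite (verts T) \<and>
     black T \<subseteq> vertex_pairs (verts T) \<and>
     red T \<subseteq> vertex_pairs (verts T) \<and>
     black T \<inter> red T = {}"

definition adjacent :: "'a trigraph \<Rightarrow> 'a \<Rightarrow> 'a \<Rightarrow> bool" where
  "adjacent T x y \<longleftrightarrow> {x, y} \<in> black T \<union> red T"

definition red_degree :: "'a trigraph \<Rightarrow> 'a \<Rightarrow> nat" where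
  "red_degree T x = card {e \<in> red T. x \<in> e}"

definition contract :: "'a trigraph \<Rightarrow> 'a \<Rightarrow> 'a \<Rightarrow> 'a \<Rightarrow> 'a trigraph" where
  "contract T u v w =
     \<lparr> verts = insert w (verts T - {u, v}),
       black = {e \<in> black T. u \<notin> e \<and> v \<notin> e} \<union>
               {{w, x} | x. x \<in> verts T - {u, v} \<and>
                  {u, x} \<in> black T \<and> {v, x} \<in> black T},
       red = {e \<in> red T. u \<notin> e \<and> v \<notin> e} \<union>
             {{w, x} | x. x \<in> verts T - {u, v} \<and>
                (adjacent T u x \<noteq> adjacent T v x \<or>
                 adjacent T u x \<and> adjacent T v x \<and>
                   \<not> ({u, x} \<in> black T \<and> {v, x} \<in> black T))} \<rparr>"

text \<open>The name of the new vertex is immaterial. It only has to differ from the surviving vertices,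
  so the names \<open>u\<close> and \<open>v\<close> of the two removed vertices may be reused. Insisting on a name outside
  \<open>verts T\<close> would rule out all contractions when the vertex set exhausts a finite type.\<close>

definition is_contraction :: "'a trigraph \<Rightarrow> 'a trigraph \<Rightarrow> bool" where
  "is_contraction T T' \<longleftrightarrow>
     (\<exists>u v w. u \<in> verts T \<and> v \<in> verts T \<and> u \<noteq> v \<and> w \<notin> verts T - {u, v} \<and>
        T' = contract T u v w)"

definition simple_graph :: "'a set \<Rightarrow> 'a set set \<Rightarrow> bool" where
  "simple_graph V E \<longleftrightarrow> finite V \<and> E \<subseteq> vertex_pairs V"

definition trigraph_of :: "'a set \<Rightarrow> 'a set set \<Rightarrow> 'a trigraph" where
  "trigraph_of V E = \<lparr> verts = V, black = E, red = {} \<rparr>"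

text \<open>\<open>S i\<close> is the trigraph with \<open>i\<close> vertices; values outside \<open>{1..card V}\<close> are irrelevant.\<close>

definition d_sequence :: "nat \<Rightarrow> 'a set \<Rightarrow> 'a set set \<Rightarrow> (nat \<Rightarrow> 'a trigraph) \<Rightarrow> bool" where
  "d_sequence d V E S \<longleftrightarrow>
     S (card V) = trigraph_of V E \<and>
     (\<forall>i \<in> {1..card V}. is_trigraph (S i)) \<and>
     (\<forall>i \<in> {2..card V}. is_contraction (S i) (S (i - 1))) \<and>
     (\<forall>i \<in> {1..card V}. \<forall>x \<in> verts (S i). red_degree (S i) x \<le> d)"

definition tww :: "'a set \<Rightarrow> 'a set set \<Rightarrow> nat" where
  "tww V E = (LEAST d. \<exists>S. d_sequence d V E S)"

lemma is_trigraph_contract: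
  assumes T: "is_trigraph T" and "w \<notin> verts T - {u, v}"
  shows "is_trigraph (contract T u v w)"
proof -
  have old: "e \<in> vertex_pairs (insert w (verts T - {u, v})) \<and> (w \<notin> e)"
    if "e \<in> vertex_pairs (verts T)" "u \<notin> e" "v \<notin> e" for e
    using that assms(2) unfolding vertex_pairs_def by auto
  have new: "{w, x} \<in> vertex_pairs (insert w (verts T - {u, v}))"
    if "x \<in> verts T - {u, v}" for x
    using that assms(2) unfolding vertex_pairs_def by blast
  show ?thesis
    unfolding is_trigraph_def
  proof (intro conjI)
    show "finite (verts (contract T u v w))"
      using T by (simp add: contract_def is_trigraph_def)
    have bT: "black T \<subseteq> vertex_pairs (verts T)" and rT: "red T \<subseteq> vertex_pairs (verts T)"
      using T by (simp_all add: is_trigraph_def)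
    show "black (contract T u v w) \<subseteq> vertex_pairs (verts (contract T u v w))"
      unfolding contract_def trigraph.simps using bT old new by blast
    show "red (contract T u v w) \<subseteq> vertex_pairs (verts (contract T u v w))"
      unfolding contract_def trigraph.simps using rT old new by blast
    have "False" if b: "e \<in> black (contract T u v w)" and r: "e \<in> red (contract T u v w)" for e
    proof (cases "w \<in> e")
      case True
      have "\<not> (e \<in> black T \<and> u \<notin> e \<and> v \<notin> e)" "\<not> (e \<in> red T \<and> u \<notin> e \<and> v \<notin> e)"
        using bT rT old True by blast+
      then obtain x y where "e = {w, x}" "x \<in> verts T - {u, v}" "{u, x} \<in> black T" "{v, x} \<in> black T"
        "e = {w, y}" "y \<in> verts T - {u, v}"
        "adjacent T u y \<noteq> adjacent T v y \<or> \<not> ({u, y} \<in> black T \<and> {v, y} \<in> black T)"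
        using b r unfolding contract_def trigraph.simps by blast
      moreover from this have "x = y" using assms(2) by (auto simp: doubleton_eq_iff)
      ultimately show False by (auto simp: adjacent_def)
    next
      case False
      then show False using b r T by (auto simp: contract_def is_trigraph_def)
    qed
    then show "black (contract T u v w) \<inter> red (contract T u v w) = {}" by blast
  qed
qed

lemma card_verts_contract:
  assumes "finite (verts T)" "u \<in> verts T" "v \<in> verts T" "u \<noteq> v" "w \<notin> verts T - {u, v}"
  shows "card (verts (contract T u v w)) = card (verts T) - 1"
proof -
  have "card {u, v} \<le> card (verts T)" using assms by (intro card_mono) auto
  then show ?thesis using assms by (simp add: contract_def card_Diff_subset)
qed

lemma contraction_sequence_exists:
  assumes "is_trigraph T" "card (verts T) = Suc n"
  shows "\<exists>S. S (Suc n) = T \<and> (\<forall>i \<in> {1..Suc n}. is_trigraph (S i)) \<and>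
           (\<forall>i \<in> {2..Suc n}. is_contraction (S i) (S (i - 1)))"
  using assms
proof (induction n arbitrary: T)
  case 0
  then show ?case by (intro exI[of _ "\<lambda>_. T"]) auto
next
  case (Suc n)
  then have fin: "finite (verts T)" by (simp add: is_trigraph_def)
  obtain u where u: "u \<in> verts T"
    using Suc.prems(2) by (metis card.empty ex_in_conv nat.distinct(1))
  have "card (verts T - {u}) = Suc n" using Suc.prems(2) u fin by simp
  then obtain v where "v \<in> verts T - {u}" by (metis card.empty ex_in_conv nat.distinct(1))
  then have v: "v \<in> verts T" "u \<noteq> v" by auto
  let ?T' = "contract T u v u"
  have "is_trigraph ?T'" "card (verts ?T') = Suc n"
    using Suc.prems fin u v by (simp_all add: is_trigraph_contract card_verts_contract)
  then obtain S where S: "S (Suc n) = ?T'" "\<forall>i \<in> {1..Suc n}. is_trigraph (S i)"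
    "\<forall>i \<in> {2..Suc n}. is_contraction (S i) (S (i - 1))"
    using Suc.IH by blast
  have "is_contraction T ?T'" unfolding is_contraction_def using u v by blast
  have "is_trigraph ((S(Suc (Suc n) := T)) i)" if "i \<in> {1..Suc (Suc n)}" for i
    using that S(2) Suc.prems(1) by (cases "i = Suc (Suc n)") auto
  moreover have "is_contraction ((S(Suc (Suc n) := T)) i) ((S(Suc (Suc n) := T)) (i - 1))"
    if "i \<in> {2..Suc (Suc n)}" for i
  proof (cases "i = Suc (Suc n)")
    case True
    then show ?thesis using S(1) \<open>is_contraction T ?T'\<close> by simp
  next
    case False
    then have "i \<in> {2..Suc n}" "i - 1 \<noteq> Suc (Suc n)" using that by auto
    then show ?thesis using S(3) False by simp
  qed
  ultimately show ?case by (intro exI[of _ "S(Suc (Suc n) := T)"]) simp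
qed

text \<open>The minimum in the definition of \<^const>\<open>tww\<close> is attained for every nonempty graph.\<close>

lemma d_sequence_tww:
  assumes "simple_graph V E" "V \<noteq> {}"
  shows "\<exists>S. d_sequence (tww V E) V E S"
proof -
  have fin: "finite V" using assms by (simp add: simple_graph_def)
  then obtain n where n: "card V = Suc n" using assms(2) by (cases "card V") auto
  have "is_trigraph (trigraph_of V E)"
    using assms by (simp add: is_trigraph_def trigraph_of_def simple_graph_def)
  then obtain S where S: "S (Suc n) = trigraph_of V E" "\<forall>i \<in> {1..Suc n}. is_trigraph (S i)"
    "\<forall>i \<in> {2..Suc n}. is_contraction (S i) (S (i - 1))"
    using contraction_sequence_exists[of "trigraph_of V E" n] n by (auto simp: trigraph_of_def)
  define d where "d = (\<Sum>i \<in> {1..Suc n}. card (red (S i)))"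
  have "red_degree (S i) x \<le> d" if "i \<in> {1..Suc n}" for i x
  proof -
    have "red (S i) \<subseteq> Pow (verts (S i))" "finite (verts (S i))"
      using S(2)[rule_format, OF that] unfolding is_trigraph_def vertex_pairs_def by blast+
    then have "finite (red (S i))" by (meson finite_Pow_iff finite_subset)
    then have "red_degree (S i) x \<le> card (red (S i))"
      unfolding red_degree_def by (intro card_mono) auto
    also have "\<dots> \<le> d" unfolding d_def using that by (intro member_le_sum) auto
    finally show ?thesis .
  qed
  then have "d_sequence d V E S" using S n by (simp add: d_sequence_def)
  then have "\<exists>d S. d_sequence d V E S" by blast
  then show ?thesis unfolding tww_def by (rule LeastI_ex)
qed

end

theory Submission imports Defs begin

text \<open>Contracting \<open>u\<close> and \<open>v\<close> in a 5-vertex graph creates red edges only towards the three other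
  vertices, so it suffices that one of these three, \<open>x\<close>, does not distinguish \<open>u\<close> from \<open>v\<close>. Such a
  triple exists by the pigeonhole principle: fix \<open>x\<close>; among any three other vertices, two agree on
  adjacency to \<open>x\<close>. The result has at most 2 red edges, and from the next contraction on there are
  at most 3 vertices, so every continuation has red degree at most 2.\<close>

text \<open>A red edge at \<open>x\<close> is determined by its other endpoint. This settles every
  trigraph with at most 3 vertices.\<close>

lemma red_degree_le_card:
  assumes "is_trigraph T" "x \<in> verts T"
  shows "red_degree T x \<le> card (verts T) - 1"
proof -
  have fin: "finite (verts T)" and sub: "red T \<subseteq> vertex_pairs (verts T)"
    using assms(1) by (simp_all add: is_trigraph_def)
  have "{e \<in> red T. x \<in> e} \<subseteq> (\<lambda>y. {x, y}) ` (verts T - {x})"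
    using sub unfolding vertex_pairs_def by (auto simp: insert_commute)
  then have "red_degree T x \<le> card (verts T - {x})"
    unfolding red_degree_def using fin by (intro surj_card_le) auto
  then show ?thesis using fin assms(2) by simp
qed

lemma card_verts_contraction:
  assumes "is_trigraph T" "is_contraction T T'"
  shows "card (verts T') = card (verts T) - 1"
proof -
  obtain u v w where "u \<in> verts T" "v \<in> verts T" "u \<noteq> v" "w \<notin> verts T - {u, v}"
    and T': "T' = contract T u v w"
    using assms(2) unfolding is_contraction_def by blast
  then show ?thesis
    unfolding T' using assms(1) by (intro card_verts_contract) (simp_all add: is_trigraph_def)
qed

lemma red_contract_trigraph_of:
  "red (contract (trigraph_of V E) u v w) =
     {{w, y} | y. y \<in> V - {u, v} \<and> ({u, y} \<in> E) \<noteq> ({v, y} \<in> E)}"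
proof -
  \<comment> \<open>Without red edges, adjacent means joined by a black edge, so the clause for
    common neighbours in \<open>contract\<close> contradicts itself.\<close>
  have "(a \<noteq> b \<or> a \<and> b \<and> \<not> (a \<and> b)) = (a \<noteq> b)" for a b by blast
  then show ?thesis by (simp add: contract_def trigraph_of_def adjacent_def del: de_Morgan_conj)
qed

lemma exists_agreeing_pair:
  fixes P :: "'a \<Rightarrow> 'a \<Rightarrow> bool"
  assumes "card V \<ge> 4"
  obtains u v x where "u \<in> V" "v \<in> V" "x \<in> V" "distinct [u, v, x]" "P u x = P v x"
proof -
  have "V \<noteq> {}" using assms by auto
  then obtain x where x: "x \<in> V" by blast
  then have "3 \<le> card (V - {x})" using assms by (simp add: card_Diff_singleton)
  then obtain W where W: "W \<subseteq> V - {x}" "card W = 3"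
    by (rule obtain_subset_with_card_n)
  then obtain a b c where abc: "W = {a, b, c}" "a \<noteq> b" "b \<noteq> c" "a \<noteq> c"
    unfolding card_3_iff by blast
  consider "P a x = P b x" | "P a x = P c x" | "P b x = P c x" by blast
  then show thesis
  proof cases
    case 1
    show thesis by (rule that[OF _ _ x _ 1]) (use W(1) abc in auto)
  next
    case 2
    show thesis by (rule that[OF _ _ x _ 2]) (use W(1) abc in auto)
  next
    case 3
    show thesis by (rule that[OF _ _ x _ 3]) (use W(1) abc in auto)
  qed
qed

theorem theorem1p2:
  fixes V :: "'a set" and E :: "'a set set"
  assumes "simple_graph V E" and "card V = 5"
  shows "tww V E \<le> 2"
proof -
  let ?T = "trigraph_of V E"
  have fin: "finite V" and T: "is_trigraph ?T" and vT: "verts ?T = V"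
    using assms(1) by (auto simp: is_trigraph_def trigraph_of_def simple_graph_def)
  obtain u v x where uvx: "u \<in> V" "v \<in> V" "x \<in> V" "distinct [u, v, x]"
    and agree: "({u, x} \<in> E) = ({v, x} \<in> E)"
    by (rule exists_agreeing_pair[of V "\<lambda>y x. {y, x} \<in> E"]) (simp add: assms(2))
  \<comment> \<open>The merged vertex reuses the name \<open>u\<close>, since \<open>'a\<close> may
    have no element outside \<open>V\<close>.\<close>
  define T' where "T' = contract ?T u v u"
  have T': "is_trigraph T'" "is_contraction ?T T'"
    unfolding T'_def is_contraction_def using T vT uvx by (auto intro!: is_trigraph_contract)
  have cT': "card (verts T') = Suc 3"
    using card_verts_contraction[OF T T'(2)] vT assms(2) by simp
  have "red T' \<subseteq> (\<lambda>y. {u, y}) ` (V - {u, v, x})"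
    unfolding T'_def red_contract_trigraph_of using agree by auto
  moreover have "card (V - {u, v, x}) = 2"
    using fin uvx assms(2) by (simp add: card_Diff_subset)
  ultimately have fin_red: "finite (red T')" and "card (red T') \<le> 2"
    using fin finite_surj surj_card_le by (metis finite_Diff)+
  then have dT': "red_degree T' y \<le> 2" for y
    using card_mono[OF fin_red, of "{e \<in> red T'. y \<in> e}"] by (simp add: red_degree_def)
  obtain S :: "nat \<Rightarrow> 'a trigraph" where S: "S 4 = T'" "\<forall>i \<in> {1..4}. is_trigraph (S i)"
    "\<forall>i \<in> {2..4}. is_contraction (S i) (S (i - 1))"
    using contraction_sequence_exists[OF T'(1) cT'] by auto
  \<comment> \<open>The choice of \<open>S\<close> does not record the sizes below
    \<open>S 4\<close>; they are recovered one contraction at a time.\<close>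
  have step: "card (verts (S (i - 1))) = card (verts (S i)) - 1" if "i \<in> {2..4}" for i
    using card_verts_contraction[of "S i"] S(2,3) that by simp
  have "card (verts (S 3)) = 3" using step[of 4] S(1) cT' by simp
  moreover from this have "card (verts (S 2)) = 2" using step[of 3] by simp
  moreover from this have "card (verts (S 1)) = 1" using step[of 2] by simp
  ultimately have "red_degree (S i) y \<le> 2" if "i \<in> {1, 2, 3}" "y \<in> verts (S i)" for i y
    using red_degree_le_card[of "S i" y] that S(2) by auto
  moreover have "red_degree ?T y \<le> 2" for y by (simp add: red_degree_def trigraph_of_def)
  moreover have "is_contraction (S 2) (S 1)" "is_contraction (S 3) (S 2)" "is_contraction (S 4) (S 3)"
    using S(3)[rule_format, of 2] S(3)[rule_format, of 3] S(3)[rule_format, of 4] by simp_all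
  moreover have "{1..5} = {1, 2, 3, 4, 5::nat}" "{2..5} = {2, 3, 4, 5::nat}" by auto
  \<comment> \<open>Updating at 5 puts the graph in front of \<open>S\<close> and leaves indices 1
    to 4 intact; the step from 5 to 4 is the contraction to \<open>T'\<close>.\<close>
  ultimately have "d_sequence 2 V E (S(5 := ?T))"
    unfolding d_sequence_def assms(2) using S T T' dT' by simp
  then show ?thesis unfolding tww_def by (blast intro: Least_le)
qed

end
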